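(* Let $A\in\mathbb{Z}^{d\times n}$ be an integral matrix such that $\operatorname{cone}(A)$ is pointed, and let $k\ge 1$ be an integer. Then $\mathrm{Sg}_{\ge k}(A)$ is a finite (possibly empty) union of translated copies of the semigroup $A\mathbb{Z}^n_{\ge 0}=\{A\lambda:\lambda\in\mathbb{Z}^n_{\ge 0}\}$.
   Context: $\operatorname{cone}(A)\subset\mathbb{R}^d$ is the cone of nonnegative real linear combinations of the columns of $A$. $\mathrm{Sg}_{\ge k}(A)$ is the set of all $b\in\operatorname{cone}(A)\cap\mathbb{Z}^d$ such that there are at least $k$ distinct $x\in\mathbb{Z}^n_{\ge0}$ with $Ax=b$. *)

theory Defs
  imports "HOL-Analysis.Analysis"
begin

definition real_vec :: "int ^ 'd \<Rightarrow> real ^ 'd" where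
  "real_vec b = (\<chi> i. real_of_int (b $ i))"

definition mat_cone :: "int ^ 'n ^ 'd \<Rightarrow> (real ^ 'd) set" where
  "mat_cone A =
     {\<Sum>j\<in>UNIV. c j *\<^sub>R real_vec (column j A) | c :: 'n \<Rightarrow> real. \<forall>j. 0 \<le> c j}"

text \<open>A cone is pointed if its lineality space \<open>C \<inter> - C\<close> is trivial.\<close>

definition pointed :: "'a::real_vector set \<Rightarrow> bool" where
  "pointed C \<longleftrightarrow> C \<inter> uminus ` C = {0}"

definition nonneg_vecs :: "(int ^ 'n) set" where
  "nonneg_vecs = {x. \<forall>j. 0 \<le> x $ j}"

definition mat_semigroup :: "int ^ 'n ^ 'd \<Rightarrow> (int ^ 'd) set" where
  "mat_semigroup A = {A *v l | l. l \<in> nonneg_vecs}"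

definition fiber :: "int ^ 'n ^ 'd \<Rightarrow> int ^ 'd \<Rightarrow> (int ^ 'n) set" where
  "fiber A b = {x \<in> nonneg_vecs. A *v x = b}"

text \<open>Fibers may be infinite (where \<open>card\<close> is 0), so ``at least \<open>k\<close> distinct solutions'' is
  expressed by a \<open>k\<close>-element subset of the fiber.\<close>

definition Sg_ge :: "nat \<Rightarrow> int ^ 'n ^ 'd \<Rightarrow> (int ^ 'd) set" where
  "Sg_ge k A =
     {b. real_vec b \<in> mat_cone A \<and> (\<exists>X. X \<subseteq> fiber A b \<and> finite X \<and> card X = k)}"

end

theory Submission
  imports Defs
begin

text \<open>The vectors \<open>x \<ge> 0\<close> whose image \<open>A x\<close> has at least \<open>k\<close> preimages form an upward closed
  set, because translation by \<open>l \<ge> 0\<close> embeds the fiber of \<open>A x\<close> into that of \<open>A (x + l)\<close>. By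
  Dickson's lemma this set is a finite union of translated orthants, and \<open>A\<close> maps it onto
  \<open>Sg_ge k A\<close>.\<close>

text \<open>Induction on the set \<open>J\<close> of coordinates, with \<open>S\<close> arbitrary so
  that the hypothesis also applies to slices of \<open>S\<close>. A set \<open>B\<close> that works
  for \<open>J\<close> can fail for a new coordinate \<open>i\<close> only at points where
  \<open>f i\<close> lies below its bound on \<open>B\<close>; these points fill finitely many
  slices.\<close>

lemma dickson:
  fixes f :: "'i \<Rightarrow> 'b \<Rightarrow> nat"
  assumes "finite J"
  shows "\<exists>B \<subseteq> S. finite B \<and> (\<forall>s\<in>S. \<exists>b\<in>B. \<forall>j\<in>J. f j b \<le> f j s)"
  using assms
proof (induction J arbitrary: S rule: finite_induct)
  case empty
  show ?case
  proof (cases "S = {}")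
    case False
    then obtain s where "s \<in> S" by blast
    then show ?thesis by (intro exI[of _ "{s}"]) auto
  qed auto
next
  case (insert i J)
  obtain B where B: "B \<subseteq> S" "finite B" "\<forall>s\<in>S. \<exists>b\<in>B. \<forall>j\<in>J. f j b \<le> f j s"
    using insert.IH[of S] by blast
  \<comment> \<open>On a slice where \<open>f i\<close> is constant, comparison on \<open>J\<close>
    already gives comparison on \<open>insert i J\<close>.\<close>
  have "\<exists>C. C \<subseteq> {s \<in> S. f i s = v} \<and> finite C \<and>
      (\<forall>s\<in>{s \<in> S. f i s = v}. \<exists>b\<in>C. \<forall>j\<in>J. f j b \<le> f j s)" for v
    by (rule insert.IH)
  then obtain C where C: "\<And>v. C v \<subseteq> {s \<in> S. f i s = v}" "\<And>v. finite (C v)"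
      "\<And>v. \<forall>s\<in>{s \<in> S. f i s = v}. \<exists>b\<in>C v. \<forall>j\<in>J. f j b \<le> f j s"
    by metis
  obtain N where N: "\<forall>b\<in>B. f i b \<le> N"
    using finite_nat_set_iff_bounded_le[of "f i ` B"] B(2) by auto
  show ?case
  \<comment> \<open>Slices below \<open>N\<close> are enough: if \<open>f i s\<close> is at least
    \<open>N\<close>, it bounds \<open>f i\<close> on all of \<open>B\<close>.\<close>
  proof (intro exI[of _ "B \<union> (\<Union>v<N. C v)"] conjI ballI)
    show "B \<union> (\<Union>v<N. C v) \<subseteq> S" using B(1) C(1) by blast
    show "finite (B \<union> (\<Union>v<N. C v))" using B(2) C(2) by blast
    fix s assume s: "s \<in> S"
    show "\<exists>b\<in>B \<union> (\<Union>v<N. C v). \<forall>j\<in>insert i J. f j b \<le> f j s"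
    proof (cases "f i s < N")
      case True
      obtain b where "b \<in> C (f i s)" "\<forall>j\<in>J. f j b \<le> f j s"
        using C(3)[of "f i s"] s by blast
      moreover from this have "f i b = f i s" using C(1) by blast
      ultimately show ?thesis using True by (intro bexI[of _ b]) auto
    next
      case False
      obtain b where "b \<in> B" "\<forall>j\<in>J. f j b \<le> f j s" using B(3) s by blast
      then show ?thesis using N False by (intro bexI[of _ b]) force+
    qed
  qed
qed

lemma nonneg_vecs_add: "x \<in> nonneg_vecs \<Longrightarrow> y \<in> nonneg_vecs \<Longrightarrow> x + y \<in> nonneg_vecs"
  by (simp add: nonneg_vecs_def)

lemma real_vec_mult_in_mat_cone:
  assumes "x \<in> nonneg_vecs"
  shows "real_vec (A *v x) \<in> mat_cone A"
proof -
  have "real_vec (A *v x) = (\<Sum>j\<in>UNIV. real_of_int (x $ j) *\<^sub>R real_vec (column j A))"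
    by (simp add: vec_eq_iff real_vec_def matrix_vector_mult_def column_def mult.commute)
  then show ?thesis
    using assms unfolding mat_cone_def nonneg_vecs_def
    by (intro CollectI exI[of _ "\<lambda>j. real_of_int (x $ j)"]) auto
qed

lemma Sg_ge_add:
  assumes "b \<in> Sg_ge k A" "l \<in> nonneg_vecs" "A *v x = b" "x \<in> nonneg_vecs"
  shows "b + A *v l \<in> Sg_ge k A"
proof -
  obtain X where X: "X \<subseteq> fiber A b" "finite X" "card X = k"
    using assms(1) unfolding Sg_ge_def by blast
  have "(+) l ` X \<subseteq> fiber A (b + A *v l)"
    using X(1) assms(2) nonneg_vecs_add
    by (auto simp: fiber_def matrix_vector_right_distrib add.commute)
  moreover have "card ((+) l ` X) = k"
    using X(3) by (simp add: card_image)
  \<comment> \<open>The preimage \<open>x\<close> of \<open>b\<close> enters here: the new point is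
    the image of the nonnegative vector \<open>x + l\<close>.\<close>
  moreover have "real_vec (b + A *v l) \<in> mat_cone A"
    using real_vec_mult_in_mat_cone[OF nonneg_vecs_add[OF assms(4,2)], of A] assms(3)
    by (simp add: matrix_vector_right_distrib)
  ultimately show ?thesis
    using X(2) unfolding Sg_ge_def by blast
qed

lemma Sg_ge_obtain_preimage:
  assumes "b \<in> Sg_ge k A" "k \<ge> 1"
  obtains x where "x \<in> nonneg_vecs" "A *v x = b"
proof -
  obtain X where "X \<subseteq> fiber A b" "card X = k"
    using assms(1) unfolding Sg_ge_def by blast
  \<comment> \<open>For \<open>k = 0\<close> the set \<open>X\<close> could be empty, and an integer
    point of the cone may have no integral preimage.\<close>
  moreover from this have "X \<noteq> {}" using assms(2) by auto
  ultimately show ?thesis using that unfolding fiber_def by blast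
qed

theorem corollary1:
  fixes A :: "int ^ 'n ^ 'd" and k :: nat
  assumes "pointed (mat_cone A)"
    and "k \<ge> 1"
  shows "\<exists>T :: (int ^ 'd) set. finite T \<and> Sg_ge k A = (\<Union>t\<in>T. (+) t ` mat_semigroup A)"
proof -
  define U where "U = {x \<in> nonneg_vecs. A *v x \<in> Sg_ge k A}"
  obtain B where B: "B \<subseteq> U" "finite B"
      "\<forall>x\<in>U. \<exists>b\<in>B. \<forall>j\<in>UNIV. nat (b $ j) \<le> nat (x $ j)"
    \<comment> \<open>Since \<open>U\<close> lies in \<open>nonneg_vecs\<close>, passing to
      \<open>nat\<close> preserves the order of coordinates.\<close>
    using dickson[OF finite_class.finite_UNIV, of U "\<lambda>j x. nat (x $ j)"] by blast
  have "Sg_ge k A = (\<Union>t\<in>(*v) A ` B. (+) t ` mat_semigroup A)"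
  proof (intro equalityI subsetI)
    fix c assume c: "c \<in> Sg_ge k A"
    then obtain x where x: "x \<in> nonneg_vecs" "A *v x = c"
      using Sg_ge_obtain_preimage assms(2) by blast
    then have "x \<in> U" using c by (simp add: U_def)
    then obtain b where b: "b \<in> B" "\<forall>j. nat (b $ j) \<le> nat (x $ j)"
      using B(3) by blast
    have "x - b \<in> nonneg_vecs"
      using b(2) x(1) by (auto simp: nonneg_vecs_def nat_le_eq_zle nat_le_iff)
    \<comment> \<open>The translation vector is \<open>A *v b\<close>, and the nonnegative
      difference \<open>x - b\<close> supplies the semigroup element.\<close>
    moreover have "c = A *v b + A *v (x - b)"
      by (simp add: x(2) flip: matrix_vector_right_distrib)
    ultimately show "c \<in> (\<Union>t\<in>(*v) A ` B. (+) t ` mat_semigroup A)"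
      using b(1) unfolding mat_semigroup_def by blast
  next
    fix c assume "c \<in> (\<Union>t\<in>(*v) A ` B. (+) t ` mat_semigroup A)"
    then obtain b l where "b \<in> B" "l \<in> nonneg_vecs" "c = A *v b + A *v l"
      unfolding mat_semigroup_def by blast
    then show "c \<in> Sg_ge k A"
      using B(1) Sg_ge_add unfolding U_def by blast
  qed
  then show ?thesis using B(2) by blast
qed

end
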